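(* Let $j\geq 1$ be an integer and assume that every $2^{j+1}$-potent ring is commutative. Let $i>j$ be an integer and let $R$ be a $(2^i+2^j)$-potent ring. Then $R$ is commutative.
   Context: Rings are associative but are not assumed to have a unity. For an integer $n\geq 2$, a ring $R$ is called $n$-potent if $x^n=x$ for all $x\in R$. *)

theory Defs
  imports "HOL-Algebra.Ring"
begin

text \<open>
  The library locale \<open>ring\<close> demands a unity. The following locale is for associative rings that
  need not have one. It reuses the library's ring records; their \<open>one\<close> field is unconstrained
  and is never referred to.
\<close>

locale nonunital_ring = abelian_group R for R (structure) +
  assumes m_closed: "\<lbrakk> x \<in> carrier R; y \<in> carrier R \<rbrakk> \<Longrightarrow> x \<otimes> y \<in> carrier R"
    and m_assoc: "\<lbrakk> x \<in> carrier R; y \<in> carrier R; z \<in> carrier R \<rbrakk>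
      \<Longrightarrow> (x \<otimes> y) \<otimes> z = x \<otimes> (y \<otimes> z)"
    and l_distr: "\<lbrakk> x \<in> carrier R; y \<in> carrier R; z \<in> carrier R \<rbrakk>
      \<Longrightarrow> (x \<oplus> y) \<otimes> z = x \<otimes> z \<oplus> y \<otimes> z"
    and r_distr: "\<lbrakk> x \<in> carrier R; y \<in> carrier R; z \<in> carrier R \<rbrakk>
      \<Longrightarrow> z \<otimes> (x \<oplus> y) = z \<otimes> x \<oplus> z \<otimes> y"

text \<open>
  The library power \<open>[^]\<close> starts its recursion at \<open>\<one>\<close>, so it is unusable without a unity. Here
  the product of \<open>n\<close> factors \<open>x\<close> is obtained by multiplying \<open>x\<close> on the right by \<open>x\<close> another
  \<open>n - 1\<close> times. This is meaningful for \<open>n \<ge> 1\<close> only; the value at \<open>n = 0\<close> is junk.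
\<close>

definition pos_pow :: "('a, 'm) ring_scheme \<Rightarrow> 'a \<Rightarrow> nat \<Rightarrow> 'a" where
  "pos_pow R x n = ((\<lambda>y. y \<otimes>\<^bsub>R\<^esub> x) ^^ (n - 1)) x"

locale potent_ring = nonunital_ring R for R (structure) and n :: nat +
  assumes two_le: "2 \<le> n"
    and potent: "x \<in> carrier R \<Longrightarrow> pos_pow R x n = x"

definition commutative_mult :: "('a, 'm) ring_scheme \<Rightarrow> bool" where
  "commutative_mult R \<longleftrightarrow>
    (\<forall>x \<in> carrier R. \<forall>y \<in> carrier R. x \<otimes>\<^bsub>R\<^esub> y = y \<otimes>\<^bsub>R\<^esub> x)"

end

theory Submission
  imports Defs
begin

text \<open>
  Since \<open>n = 2\<^sup>i + 2\<^sup>j\<close> is even, \<open>- x = (- x)\<^sup>n = x\<^sup>n = x\<close>, so \<open>R\<close> has characteristic \<open>2\<close> and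
  the \<open>2\<^sup>k\<close>-th powers are additive on powers of a fixed \<open>x\<close>. Expanding \<open>(x + x\<^sup>2)\<^sup>n = x + x\<^sup>2\<close>
  with \<open>a = 2\<^sup>i\<close>, \<open>b = 2\<^sup>j\<close> as \<open>(x\<^sup>a + x\<^bsup>2a\<^esup>)(x\<^sup>b + x\<^bsup>2b\<^esup>)\<close> shows that the mixed terms
  \<open>x\<^bsup>a+2b\<^esup> = x\<^bsup>b+1\<^esup>\<close> and \<open>x\<^bsup>2a+b\<^esup> = x\<^bsup>a+1\<^esup>\<close> coincide. Multiplying by \<open>x\<^bsup>b-1\<^esup>\<close> gives
  \<open>x\<^bsup>2b\<^esup> = x\<^bsup>a+b\<^esup> = x\<close>, so \<open>R\<close> is itself \<open>2\<^bsup>j+1\<^esup>\<close>-potent.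
\<close>

context nonunital_ring
begin

lemma pos_pow_1: "pos_pow R x 1 = x"
  by (simp add: pos_pow_def)

lemma pos_pow_Suc: "1 \<le> n \<Longrightarrow> pos_pow R x (Suc n) = pos_pow R x n \<otimes> x"
  by (cases n) (simp_all add: pos_pow_def)

lemma pos_pow_closed:
  assumes "x \<in> carrier R" "1 \<le> n"
  shows "pos_pow R x n \<in> carrier R"
  using assms(2) by (induction n rule: dec_induct)
    (simp_all add: pos_pow_1[simplified] pos_pow_Suc m_closed assms(1))

lemma pos_pow_add:
  assumes "x \<in> carrier R" "1 \<le> m" "1 \<le> n"
  shows "pos_pow R x (m + n) = pos_pow R x m \<otimes> pos_pow R x n"
  using assms(3) by (induction n rule: dec_induct)
    (use assms(1,2) in \<open>simp_all add: pos_pow_1[simplified] pos_pow_Suc pos_pow_closed m_assoc\<close>)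

lemma zero_mult: "x \<in> carrier R \<Longrightarrow> \<zero> \<otimes> x = \<zero>"
  by (metis add.l_cancel_one l_distr l_zero m_closed zero_closed)

lemma mult_zero: "x \<in> carrier R \<Longrightarrow> x \<otimes> \<zero> = \<zero>"
  by (metis add.l_cancel_one r_distr l_zero m_closed zero_closed)

text \<open>Both products are additive inverses of \<open>x \<otimes> (\<ominus> y)\<close>.\<close>

lemma minus_mult_minus:
  assumes "x \<in> carrier R" "y \<in> carrier R"
  shows "(\<ominus> x) \<otimes> (\<ominus> y) = x \<otimes> y"
proof -
  have "(\<ominus> x) \<otimes> (\<ominus> y) \<oplus> x \<otimes> (\<ominus> y) = \<zero>"
    using assms by (simp flip: l_distr add: l_neg zero_mult)
  moreover have "x \<otimes> y \<oplus> x \<otimes> (\<ominus> y) = \<zero>"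
    using assms by (simp flip: r_distr add: r_neg mult_zero)
  ultimately show ?thesis
    using assms by (metis a_inv_closed add.right_cancel m_closed)
qed

lemma pos_pow_minus_even:
  assumes "x \<in> carrier R" "1 \<le> m"
  shows "pos_pow R (\<ominus> x) (2 * m) = pos_pow R x (2 * m)"
proof -
  have sq: "pos_pow R y 2 = y \<otimes> y" for y
    by (simp add: pos_pow_def)
  have step: "pos_pow R y (2 * Suc m) = pos_pow R y (2 * m) \<otimes> pos_pow R y 2"
    if "y \<in> carrier R" "1 \<le> m" for y m
    using pos_pow_add[of y "2 * m" 2] that by (simp add: add.commute)
  show ?thesis
    using assms(2) by (induction m rule: dec_induct)
      (use assms(1) in \<open>simp_all add: step sq minus_mult_minus del: mult_Suc_right One_nat_def\<close>)
qed

text \<open>Frobenius, restricted to powers of one \<open>x\<close>: these commute even though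
  \<open>R\<close> is not yet known to be commutative, so squaring the sum doubles the cross term
  \<open>u \<otimes> v\<close>, and characteristic 2 kills it.\<close>

lemma pos_pow_sum_char_2:
  assumes char2: "\<And>y. y \<in> carrier R \<Longrightarrow> y \<oplus> y = \<zero>"
    and x: "x \<in> carrier R" and "1 \<le> m" "1 \<le> l"
  shows "pos_pow R (pos_pow R x m \<oplus> pos_pow R x l) (2 ^ k)
    = pos_pow R x (m * 2 ^ k) \<oplus> pos_pow R x (l * 2 ^ k)"
proof (induction k)
  case 0
  then show ?case by (simp add: pos_pow_1[simplified])
next
  case (Suc k)
  define s where "s = pos_pow R x m \<oplus> pos_pow R x l"
  define u where "u = pos_pow R x (m * 2 ^ k)"
  define v where "v = pos_pow R x (l * 2 ^ k)"
  have ge: "1 \<le> m * 2 ^ k" "1 \<le> l * 2 ^ k"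
    using assms(3,4) by simp_all
  have cl: "s \<in> carrier R" "u \<in> carrier R" "v \<in> carrier R"
    using assms ge by (simp_all add: s_def u_def v_def pos_pow_closed)
  have comm: "v \<otimes> u = u \<otimes> v"
    using x ge by (simp add: u_def v_def add.commute flip: pos_pow_add)
  have "pos_pow R s (2 ^ Suc k) = (u \<oplus> v) \<otimes> (u \<oplus> v)"
    using pos_pow_add[of s "2 ^ k" "2 ^ k"] cl Suc by (simp add: mult_2 s_def u_def v_def)
  also have "\<dots> = u \<otimes> u \<oplus> (u \<otimes> v \<oplus> u \<otimes> v) \<oplus> v \<otimes> v"
    using cl by (simp add: l_distr r_distr comm m_closed a_ac)
  also have "\<dots> = u \<otimes> u \<oplus> v \<otimes> v"
    using cl by (simp add: char2 m_closed)
  also have "\<dots> = pos_pow R x (m * 2 ^ Suc k) \<oplus> pos_pow R x (l * 2 ^ Suc k)"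
    using x ge by (simp add: u_def v_def flip: pos_pow_add mult_2) (simp add: ac_simps)
  finally show ?case
    by (simp add: s_def)
qed

end

lemma (in potent_ring) even_potent_char_2:
  assumes "even n" "x \<in> carrier R"
  shows "x \<oplus> x = \<zero>"
proof -
  obtain m where m: "n = 2 * m" "1 \<le> m"
    using assms(1) two_le by (auto elim!: evenE)
  have "\<ominus> x = x"
    using pos_pow_minus_even[of x m] potent[of x] potent[of "\<ominus> x"] assms(2) m by simp
  then show ?thesis
    using assms(2) by (metis r_neg)
qed

lemma potent_ring_reduce:
  fixes R (structure)
  assumes "1 \<le> j" "1 \<le> i" and R: "potent_ring R (2 ^ i + 2 ^ j)"
  shows "potent_ring R (2 ^ (j + 1))"
proof -
  define a b :: nat where "a = 2 ^ i" and "b = 2 ^ j"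
  interpret potent_ring R "a + b"
    using R by (simp add: a_def b_def)
  \<comment> \<open>Evenness yields characteristic 2; \<open>2 \<le> b\<close> keeps the later
    exponent \<open>b - 1\<close> positive, where \<open>pos_pow\<close> is meaningful.\<close>
  have ab: "2 \<le> a" "2 \<le> b" "even (a + b)"
    using assms(1,2) self_le_power[of "2::nat" i] self_le_power[of "2::nat" j]
    by (simp_all add: a_def b_def)
  note char2 = even_potent_char_2[OF ab(3)]
  have "pos_pow R x (2 * b) = x" if x: "x \<in> carrier R" for x
  proof -
    let ?p = "pos_pow R x"
    have cl: "?p k \<in> carrier R" if "1 \<le> k" for k
      using x that by (rule pos_pow_closed)
    have add: "?p (k + l) = ?p k \<otimes> ?p l" if "1 \<le> k" "1 \<le> l" for k l
      using x that by (rule pos_pow_add)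
    have n: "?p (a + b) = ?p 1"
      using potent[OF x] by (simp add: pos_pow_1[simplified])
    have shift: "?p (a + b + k) = ?p (1 + k)" if "1 \<le> k" for k
      using ab that by (simp add: add[of "a + b" k] add[of 1 k] n del: One_nat_def plus_1_eq_Suc)
    have frob: "pos_pow R (?p 1 \<oplus> ?p 2) (2 ^ k) = ?p (2 ^ k) \<oplus> ?p (2 * 2 ^ k)" for k
      using pos_pow_sum_char_2[OF char2 x, of 1 2 k] by simp
    have "?p 1 \<oplus> ?p 2 = pos_pow R (?p 1 \<oplus> ?p 2) (a + b)"
      using potent cl by simp
    also have "\<dots> = (?p a \<oplus> ?p (2 * a)) \<otimes> (?p b \<oplus> ?p (2 * b))"
      using pos_pow_add[of "?p 1 \<oplus> ?p 2" a b] cl ab frob[of i] frob[of j]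
      by (simp add: a_def b_def)
    \<comment> \<open>Every exponent is written with a summand \<open>a + b\<close>, which
      \<open>n\<close> and \<open>shift\<close> can then lower to 1.\<close>
    also have "\<dots> = ?p (a + b) \<oplus> ?p (a + b + (a + b)) \<oplus> (?p (a + b + b) \<oplus> ?p (a + b + a))"
    proof -
      have e: "a + b + (a + b) = 2 * a + 2 * b" "a + b + b = a + 2 * b" "a + b + a = 2 * a + b"
        by simp_all
      show ?thesis
        unfolding e using ab by (simp add: add l_distr r_distr cl m_closed a_ac)
    qed
    also have "?p (a + b + (a + b)) = ?p 2"
      using add[of "a + b" "a + b"] add[of 1 1] ab unfolding n by (simp add: numeral_2_eq_2)
    also have "?p (a + b) = ?p 1"
      by (rule n)
    finally have "?p (a + b + b) \<oplus> ?p (a + b + a) = \<zero>"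
      using cl ab by (subst (asm) add.l_cancel_one') simp_all
    \<comment> \<open>Zero is rewritten as a doubled element, so that cancelling on the right gives
      \<open>eq\<close>.\<close>
    then have "?p (1 + b) \<oplus> ?p (1 + a) = ?p (1 + a) \<oplus> ?p (1 + a)"
      using shift ab char2 cl by simp
    then have eq: "?p (1 + b) = ?p (1 + a)"
      using cl by (metis add.right_cancel le_add1)
    \<comment> \<open>The factor \<open>?p (b - 1)\<close> is chosen because it also turns
      \<open>?p (1 + a)\<close> into \<open>?p (a + b)\<close>.\<close>
    have "?p (2 * b) = ?p (1 + b) \<otimes> ?p (b - 1)"
      using ab by (simp add: mult_2 flip: add)
    also have "\<dots> = ?p (a + b)"
      using ab unfolding eq by (simp flip: add)
    finally show ?thesis
      using n by (simp add: pos_pow_1[simplified])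
  qed
  then show ?thesis
    by unfold_locales (simp_all add: b_def)
qed

theorem theorem2p14:
  fixes i j :: nat and R :: "'a ring"
  assumes "j \<ge> 1"
    and "\<forall>S :: 'a ring. potent_ring S (2 ^ (j + 1)) \<longrightarrow> commutative_mult S"
    and "i > j"
    and "potent_ring R (2 ^ i + 2 ^ j)"
  shows "commutative_mult R"
  using assms potent_ring_reduce[of j i R] by simp

end
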